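(* Let $r\ge2$ and $q\ge1$ be integers. Then for each fixed integer $n\ge2$, the variable $$\mathcal{Z}^{(n)}_m=\sum_{1\le i_1<\cdots<i_r\le m}\gcd\big(X^{(n)}_{i_1},\ldots,X^{(n)}_{i_r}\big)^q$$ is asymptotically normal as $m\to\infty$, that is, $$\frac{\mathcal{Z}^{(n)}_m-\mathbb{E}(\mathcal{Z}^{(n)}_m)}{\sqrt{\mathbb{V}(\mathcal{Z}^{(n)}_m)}}\ \xrightarrow{\ d\ }\ \mathcal{N}\qquad\text{as } m\to\infty .$$
   Context: For each integer $n\ge1$, $X^{(n)}_1,X^{(n)}_2,\ldots$ is a sequence of independent random variables uniformly distributed in $\{1,\ldots,n\}$, defined on a probability space with probability $\mathbf{P}$; $\mathbb{E}$ and $\mathbb{V}$ denote expectation and variance. The symbol $\xrightarrow{d}$ means convergence in distribution and $\mathcal{N}$ is a standard normal variable. *)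

theory Defs
  imports "HOL-Probability.Probability"
begin

text \<open>A tuple \<open>1 \<le> i\<^sub>1 < \<dots> < i\<^sub>r \<le> m\<close> is encoded as a strictly increasing list of length \<open>r\<close>.\<close>

definition increasing_tuples :: "nat \<Rightarrow> nat \<Rightarrow> nat list set" where
  "increasing_tuples r m = {is. length is = r \<and> sorted_wrt (<) is \<and> set is \<subseteq> {1..m}}"

text \<open>\<open>gcd_power_sum r q X m\<close> is the random variable \<open>Z\<^sub>m\<close>. Since gcd ignores repetitions,
  the gcd of the tuple of values is the gcd of the set of its entries.\<close>

definition gcd_power_sum ::
    "nat \<Rightarrow> nat \<Rightarrow> (nat \<Rightarrow> 'a \<Rightarrow> nat) \<Rightarrow> nat \<Rightarrow> 'a \<Rightarrow> real" where
  "gcd_power_sum r q X m \<omega> =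
     (\<Sum>is\<in>increasing_tuples r m. real (Gcd (set (map (\<lambda>i. X i \<omega>) is))) ^ q)"

end

theory Submission
  imports Defs
begin

text \<open>
  The power \<open>x ^ q\<close> is the sum of \<open>J d\<close> over the divisors \<open>d\<close> of \<open>x\<close>, for suitable coefficients \<open>J\<close> (Jordan's
  totient function). Applied to a gcd this gives, almost surely, \<open>Z m = (\<Sum>d\<in>{1..n}. J d * (N d m choose r))\<close>, where
  \<open>N d m\<close> is the number of indices \<open>i \<le> m\<close> with \<open>d dvd X i\<close> (\<open>gcd_power_sum_eq_divisor_sum\<close>). So the
  statistic is a polynomial in finitely many binomially distributed counts.

  Each count deviates from its mean \<open>m * p d\<close> by about \<open>\<surd>m\<close>. Replacing every \<open>N d m choose r\<close> by its
  linearization at the mean (\<open>binomial_linearization_error\<close>) therefore gives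
  \<open>Z m = a m + c m * (\<Sum>i<m. Y i) + error\<close>, where \<open>c m\<close> is of order \<open>m ^ (r - 1)\<close>, the variables \<open>Y i = g (X (i + 1))\<close>
  are i.i.d. and centered, and the error is of order \<open>m ^ (r - 1)\<close> in \<open>L\<^sup>2\<close>; the latter rests on the fourth
  moment bound \<open>fourth_moment_sum_le\<close>. The linear term is of order \<open>m ^ (r - 1/2)\<close>, provided that \<open>Y\<close> is not
  almost surely constant, and so it dominates.

  The classical central limit theorem gives a normal limit for the linear term, and
  \<open>standardization_weak_conv\<close> transfers it to \<open>Z m\<close>: an \<open>L\<^sup>2\<close>-negligible perturbation affects neither the
  limit law nor, asymptotically, the mean and the variance used for the standardization.

  Finally \<open>Y\<close> is nondegenerate because \<open>n \<ge> 2\<close>: the values 1 and 2 both occur with positive probability, and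
  \<open>g 2 - g 1 = J 2 * p 2 ^ (r - 1)\<close> with \<open>J 2 = 2 ^ q - 1 > 0\<close>.
\<close>

section \<open>Perturbation of weakly convergent sequences\<close>

lemma norm_iexp_diff_le: "norm (exp (\<i> * complex_of_real a) - exp (\<i> * complex_of_real b)) \<le> \<bar>a - b\<bar>"
proof -
  have "exp (\<i> * complex_of_real a) - exp (\<i> * complex_of_real b)
      = exp (\<i> * complex_of_real b) * (exp (\<i> * complex_of_real (a - b)) - 1)"
    by (simp add: algebra_simps flip: exp_add)
  then have "norm (exp (\<i> * complex_of_real a) - exp (\<i> * complex_of_real b)) = 2 * \<bar>sin ((a - b) / 2)\<bar>"
    by (simp only: norm_mult norm_exp_i_times dist_exp_i_1)
  also have "\<dots> \<le> \<bar>a - b\<bar>"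
    using abs_sin_le_one[of "(a - b) / 2"] abs_sin_x_le_abs_x[of "(a - b) / 2"] by simp
  finally show ?thesis .
qed

text \<open>Slutsky's lemma with \<open>L\<^sup>1\<close> closeness instead of closeness in probability. Since
\<open>x \<mapsto> exp (\<i> t x)\<close> is \<open>\<bar>t\<bar>\<close>-Lipschitz, the characteristic functions of the two sequences differ by at
most \<open>\<bar>t\<bar>\<close> times the \<open>L\<^sup>1\<close> distance, and Levy's continuity theorem applies.\<close>

lemma (in prob_space) weak_conv_L1_perturbation:
  fixes A B :: "nat \<Rightarrow> 'a \<Rightarrow> real"
  assumes A: "\<And>m. integrable M (A m)" and B: "\<And>m. integrable M (B m)"
    and diff: "(\<lambda>m. expectation (\<lambda>\<omega>. \<bar>A m \<omega> - B m \<omega>\<bar>)) \<longlonglongrightarrow> 0"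
    and conv: "weak_conv_m (\<lambda>m. distr M borel (B m)) N" and N: "real_distribution N"
  shows "weak_conv_m (\<lambda>m. distr M borel (A m)) N"
proof (rule levy_continuity)
  note [measurable] = borel_measurable_integrable[OF A] borel_measurable_integrable[OF B]
  show "real_distribution (distr M borel (A m))" for m by simp
  show "real_distribution N" by fact
  fix t
  have charB: "(\<lambda>m. char (distr M borel (B m)) t) \<longlonglongrightarrow> char N t"
    by (rule levy_continuity1[OF _ N conv]) simp
  have iexp_int: "integrable M (\<lambda>\<omega>. exp (\<i> * complex_of_real (t * f \<omega>)))"
    if [measurable]: "f \<in> borel_measurable M" for f
    by (rule integrable_const_bound[where B=1]) simp_all
  have "norm (char (distr M borel (A m)) t - char (distr M borel (B m)) t)
      \<le> \<bar>t\<bar> * expectation (\<lambda>\<omega>. \<bar>A m \<omega> - B m \<omega>\<bar>)" for m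
  proof -
    have "char (distr M borel (A m)) t - char (distr M borel (B m)) t =
        (CLINT \<omega>|M. exp (\<i> * complex_of_real (t * A m \<omega>)) - exp (\<i> * complex_of_real (t * B m \<omega>)))"
      unfolding char_def
      by (subst Bochner_Integration.integral_diff) (auto intro!: iexp_int simp: integral_distr simp del: of_real_mult)
    also have "norm \<dots> \<le> expectation (\<lambda>\<omega>.
        norm (exp (\<i> * complex_of_real (t * A m \<omega>)) - exp (\<i> * complex_of_real (t * B m \<omega>))))"
      by (rule integral_norm_bound)
    also have "\<dots> \<le> expectation (\<lambda>\<omega>. \<bar>t\<bar> * \<bar>A m \<omega> - B m \<omega>\<bar>)"
    proof (rule integral_mono)
      show "norm (exp (\<i> * complex_of_real (t * A m \<omega>)) - exp (\<i> * complex_of_real (t * B m \<omega>)))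
          \<le> \<bar>t\<bar> * \<bar>A m \<omega> - B m \<omega>\<bar>" for \<omega>
        using norm_iexp_diff_le[of "t * A m \<omega>" "t * B m \<omega>"]
        by (simp add: abs_mult flip: right_diff_distrib)
    qed (auto intro!: integrable_norm Bochner_Integration.integrable_diff iexp_int A B simp del: of_real_mult)
    finally show ?thesis by simp
  qed
  moreover have "(\<lambda>m. \<bar>t\<bar> * expectation (\<lambda>\<omega>. \<bar>A m \<omega> - B m \<omega>\<bar>)) \<longlonglongrightarrow> 0"
    using tendsto_mult_right_zero[OF diff] .
  ultimately have "(\<lambda>m. char (distr M borel (A m)) t - char (distr M borel (B m)) t) \<longlonglongrightarrow> 0"
    by (rule Lim_null_comparison[OF always_eventually[OF allI]])
  from tendsto_add[OF this charB] show "(\<lambda>m. char (distr M borel (A m)) t) \<longlonglongrightarrow> char N t"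
    by simp
qed

lemma (in prob_space) expectation_abs_le_sqrt:
  fixes D :: "'a \<Rightarrow> real"
  assumes D: "D \<in> borel_measurable M" "integrable M (\<lambda>\<omega>. (D \<omega>)\<^sup>2)"
  shows "expectation (\<lambda>\<omega>. \<bar>D \<omega>\<bar>) \<le> sqrt (expectation (\<lambda>\<omega>. (D \<omega>)\<^sup>2))"
proof -
  have "integrable M D" using square_integrable_imp_integrable[OF D] .
  then have "0 \<le> expectation (\<lambda>\<omega>. (D \<omega>)\<^sup>2) - (expectation (\<lambda>\<omega>. \<bar>D \<omega>\<bar>))\<^sup>2"
    using variance_eq[of "\<lambda>\<omega>. \<bar>D \<omega>\<bar>"] variance_positive[of "\<lambda>\<omega>. \<bar>D \<omega>\<bar>"] D(2) by simp
  then show ?thesis by (intro real_le_rsqrt) simp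
qed

lemma square_integrable_mult:
  fixes f g :: "'a \<Rightarrow> real"
  assumes [measurable]: "f \<in> borel_measurable M" "g \<in> borel_measurable M"
    and "integrable M (\<lambda>x. (f x)\<^sup>2)" "integrable M (\<lambda>x. (g x)\<^sup>2)"
  shows "integrable M (\<lambda>x. f x * g x)"
proof (rule Bochner_Integration.integrable_bound)
  show "integrable M (\<lambda>x. (f x)\<^sup>2 + (g x)\<^sup>2)" using assms by simp
  have "\<bar>a * b\<bar> \<le> a\<^sup>2 + b\<^sup>2" for a b :: real
  proof -
    have "2 * \<bar>a * b\<bar> \<le> a\<^sup>2 + b\<^sup>2"
      using sum_squares_bound[of "\<bar>a\<bar>" "\<bar>b\<bar>"] by (simp add: abs_mult mult.assoc)
    then show ?thesis using abs_ge_zero[of "a * b"] by linarith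
  qed
  then show "AE x in M. norm (f x * g x) \<le> norm ((f x)\<^sup>2 + (g x)\<^sup>2)" by simp
qed simp

lemma square_integrable_add:
  fixes f g :: "'a \<Rightarrow> real"
  assumes "f \<in> borel_measurable M" "g \<in> borel_measurable M"
    and "integrable M (\<lambda>x. (f x)\<^sup>2)" "integrable M (\<lambda>x. (g x)\<^sup>2)"
  shows "integrable M (\<lambda>x. (f x + g x)\<^sup>2)"
  using square_integrable_mult[OF assms] assms by (simp add: power2_sum mult.assoc)

lemma (in prob_space) variance_le_second_moment:
  fixes D :: "'a \<Rightarrow> real"
  assumes "D \<in> borel_measurable M" "integrable M (\<lambda>\<omega>. (D \<omega>)\<^sup>2)"
  shows "variance D \<le> expectation (\<lambda>\<omega>. (D \<omega>)\<^sup>2)"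
  using variance_eq[OF square_integrable_imp_integrable[OF assms] assms(2)] by simp

text \<open>The variance is continuous at \<open>B\<close> with respect to the \<open>L\<^sup>2\<close> distance: this is what allows a
standardization by the exact variance of a sum that is only known up to an \<open>L\<^sup>2\<close> error.\<close>

lemma (in prob_space) abs_variance_add_minus_one_le:
  fixes B D :: "'a \<Rightarrow> real"
  assumes [measurable]: "B \<in> borel_measurable M" "D \<in> borel_measurable M"
    and B2: "integrable M (\<lambda>\<omega>. (B \<omega>)\<^sup>2)" and D2: "integrable M (\<lambda>\<omega>. (D \<omega>)\<^sup>2)"
    and B_mean: "expectation B = 0" and B_var: "expectation (\<lambda>\<omega>. (B \<omega>)\<^sup>2) = 1"
  defines "v \<equiv> expectation (\<lambda>\<omega>. (D \<omega>)\<^sup>2)"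
  shows "\<bar>variance (\<lambda>\<omega>. B \<omega> + D \<omega>) - 1\<bar> \<le> 2 * sqrt v + v"
proof -
  have BI: "integrable M B" and DI: "integrable M D"
    using square_integrable_imp_integrable[OF _ B2] square_integrable_imp_integrable[OF _ D2] by simp_all
  define D' where "D' = (\<lambda>\<omega>. D \<omega> - expectation D)"
  have [measurable]: "D' \<in> borel_measurable M" by (simp add: D'_def)
  have D'2: "integrable M (\<lambda>\<omega>. (D' \<omega>)\<^sup>2)"
    using D2 DI by (simp add: D'_def power2_diff)
  define c where "c = expectation (\<lambda>\<omega>. B \<omega> * D' \<omega>)"
  define v' where "v' = expectation (\<lambda>\<omega>. (D' \<omega>)\<^sup>2)"
  have BD: "integrable M (\<lambda>\<omega>. B \<omega> * D' \<omega>)"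
    by (rule square_integrable_mult) (use B2 D'2 in auto)
  have "v' \<le> v" "0 \<le> v'"
    unfolding v'_def v_def D'_def using variance_le_second_moment[OF _ D2] variance_positive[of D] by auto
  have "variance (\<lambda>\<omega>. B \<omega> + D \<omega>) = expectation (\<lambda>\<omega>. (B \<omega>)\<^sup>2 + 2 * (B \<omega> * D' \<omega>) + (D' \<omega>)\<^sup>2)"
    using BI DI B_mean by (simp add: D'_def power2_eq_square algebra_simps)
  also have "\<dots> = 1 + 2 * c + v'"
    using BD B2 D'2 by (simp add: B_var c_def v'_def)
  finally have var: "variance (\<lambda>\<omega>. B \<omega> + D \<omega>) = 1 + 2 * c + v'" .
  \<comment> \<open>Cauchy-Schwarz for \<open>B\<close> and \<open>D'\<close>: \<open>c * B\<close> is the orthogonal projection of \<open>D'\<close> onto the unit vector \<open>B\<close>.\<close>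
  have "0 \<le> expectation (\<lambda>\<omega>. (D' \<omega> - c * B \<omega>)\<^sup>2)" by simp
  also have "\<dots> = expectation (\<lambda>\<omega>. (D' \<omega>)\<^sup>2 - 2 * c * (B \<omega> * D' \<omega>) + c\<^sup>2 * (B \<omega>)\<^sup>2)"
    by (simp add: power2_eq_square algebra_simps)
  also have "\<dots> = v' - 2 * c * c + c\<^sup>2"
    using BD B2 D'2 by (simp add: B_var c_def v'_def)
  finally have "c\<^sup>2 \<le> v'" by (simp add: power2_eq_square)
  with \<open>v' \<le> v\<close> have "\<bar>c\<bar> \<le> sqrt v" by (intro real_le_rsqrt) simp
  with var \<open>v' \<le> v\<close> \<open>0 \<le> v'\<close> show ?thesis by linarith
qed

text \<open>If \<open>W\<close> is \<open>L\<^sup>2\<close>-close to a standardized sequence \<open>B\<close>, then subtracting the mean of \<open>W\<close> and dividing by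
its standard deviation moves \<open>W\<close> only by a negligible amount in \<open>L\<^sup>1\<close>: the means tend to 0 and the
standard deviations to 1. Hence the standardization of \<open>W\<close> has the same limit law as \<open>B\<close>.\<close>

lemma (in prob_space) standardization_weak_conv:
  fixes W B :: "nat \<Rightarrow> 'a \<Rightarrow> real"
  assumes W[measurable]: "\<And>m. W m \<in> borel_measurable M" and W2: "\<And>m. integrable M (\<lambda>\<omega>. (W m \<omega>)\<^sup>2)"
    and B[measurable]: "\<And>m. B m \<in> borel_measurable M" and B2: "\<And>m. integrable M (\<lambda>\<omega>. (B m \<omega>)\<^sup>2)"
    and B_mean: "\<And>m. expectation (B m) = 0"
    and B_var: "\<forall>\<^sub>F m in sequentially. expectation (\<lambda>\<omega>. (B m \<omega>)\<^sup>2) = 1"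
    and diff: "(\<lambda>m. expectation (\<lambda>\<omega>. (W m \<omega> - B m \<omega>)\<^sup>2)) \<longlonglongrightarrow> 0"
    and conv: "weak_conv_m (\<lambda>m. distr M borel (B m)) N" and N: "real_distribution N"
  shows "weak_conv_m (\<lambda>m. distr M borel (\<lambda>\<omega>. (W m \<omega> - expectation (W m)) / sqrt (variance (W m)))) N"
proof (rule weak_conv_L1_perturbation[OF _ _ _ conv N])
  define v where "v m = expectation (\<lambda>\<omega>. (W m \<omega> - B m \<omega>)\<^sup>2)" for m
  define s where "s m = sqrt (variance (W m))" for m
  have WI: "integrable M (W m)" and BI: "integrable M (B m)" for m
    using square_integrable_imp_integrable[OF _ W2] square_integrable_imp_integrable[OF _ B2] by simp_all
  show "integrable M (\<lambda>\<omega>. (W m \<omega> - expectation (W m)) / sqrt (variance (W m)))" for m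
    using WI by simp
  show "integrable M (B m)" for m by fact
  have D2: "integrable M (\<lambda>\<omega>. (W m \<omega> - B m \<omega>)\<^sup>2)" for m
    using square_integrable_add[of "W m" M "\<lambda>\<omega>. - B m \<omega>"] W2 B2 by simp
  have v0: "v \<longlonglongrightarrow> 0" unfolding v_def[abs_def] by (fact diff)
  have v_bound: "(\<lambda>m. 2 * sqrt (v m) + v m) \<longlonglongrightarrow> 0"
    using tendsto_add[OF tendsto_mult_right_zero[OF tendsto_real_sqrt[OF v0, simplified], of 2] v0] by simp
  have "(\<lambda>m. variance (W m) - 1) \<longlonglongrightarrow> 0"
  proof (rule Lim_null_comparison[OF _ v_bound])
    show "\<forall>\<^sub>F m in sequentially. norm (variance (W m) - 1) \<le> 2 * sqrt (v m) + v m"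
      using B_var
    proof eventually_elim
      case (elim m)
      then show ?case
        using abs_variance_add_minus_one_le[OF B[of m] _ B2[of m] D2[of m] B_mean elim] by (simp add: v_def)
    qed
  qed
  then have "(\<lambda>m. variance (W m)) \<longlonglongrightarrow> 1" by (simp add: LIM_zero_iff)
  then have s1: "s \<longlonglongrightarrow> 1" unfolding s_def using tendsto_real_sqrt by fastforce
  have bound: "expectation (\<lambda>\<omega>. \<bar>(W m \<omega> - expectation (W m)) / s m - B m \<omega>\<bar>) \<le> \<bar>1 - s m\<bar> + 2 * sqrt (v m)"
    if pos: "s m > 0" for m
  proof -
    define C where "C = (\<lambda>\<omega>. W m \<omega> - expectation (W m))"
    have CI: "integrable M C" using WI by (simp add: C_def)
    have C2: "integrable M (\<lambda>\<omega>. (C \<omega>)\<^sup>2)" using W2 WI by (simp add: C_def power2_diff)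
    have EC: "expectation (\<lambda>\<omega>. \<bar>C \<omega>\<bar>) \<le> s m"
      using expectation_abs_le_sqrt[OF _ C2] by (simp add: s_def C_def)
    have ED: "expectation (\<lambda>\<omega>. \<bar>W m \<omega> - B m \<omega>\<bar>) \<le> sqrt (v m)"
      using expectation_abs_le_sqrt[OF _ D2] by (simp add: v_def)
    have "\<bar>expectation (W m)\<bar> = \<bar>expectation (\<lambda>\<omega>. W m \<omega> - B m \<omega>)\<bar>"
      using WI BI B_mean by simp
    also have "\<dots> \<le> expectation (\<lambda>\<omega>. \<bar>W m \<omega> - B m \<omega>\<bar>)" by (rule integral_abs_bound)
    finally have EW: "\<bar>expectation (W m)\<bar> \<le> sqrt (v m)" using ED by simp
    have "expectation (\<lambda>\<omega>. \<bar>C \<omega> / s m - B m \<omega>\<bar>)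
        \<le> expectation (\<lambda>\<omega>. \<bar>1 / s m - 1\<bar> * \<bar>C \<omega>\<bar> + (\<bar>W m \<omega> - B m \<omega>\<bar> + \<bar>expectation (W m)\<bar>))"
    proof (rule integral_mono)
      fix \<omega>
      have "C \<omega> / s m - B m \<omega> = (1 / s m - 1) * C \<omega> + ((W m \<omega> - B m \<omega>) - expectation (W m))"
        by (simp add: C_def algebra_simps diff_divide_distrib)
      then have "\<bar>C \<omega> / s m - B m \<omega>\<bar> \<le> \<bar>(1 / s m - 1) * C \<omega>\<bar> + \<bar>(W m \<omega> - B m \<omega>) - expectation (W m)\<bar>"
        by (metis abs_triangle_ineq)
      then show "\<bar>C \<omega> / s m - B m \<omega>\<bar>
          \<le> \<bar>1 / s m - 1\<bar> * \<bar>C \<omega>\<bar> + (\<bar>W m \<omega> - B m \<omega>\<bar> + \<bar>expectation (W m)\<bar>)"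
        unfolding abs_mult by linarith
    qed (use CI WI BI in auto)
    also have "\<dots> = \<bar>1 / s m - 1\<bar> * expectation (\<lambda>\<omega>. \<bar>C \<omega>\<bar>)
        + (expectation (\<lambda>\<omega>. \<bar>W m \<omega> - B m \<omega>\<bar>) + \<bar>expectation (W m)\<bar>)"
      using CI WI BI by (simp add: prob_space)
    also have "\<dots> \<le> \<bar>1 / s m - 1\<bar> * s m + (sqrt (v m) + sqrt (v m))"
      using EC ED EW by (intro add_mono mult_left_mono) auto
    also have "\<bar>1 / s m - 1\<bar> * s m = \<bar>1 - s m\<bar>"
    proof -
      have "\<bar>1 / s m - 1\<bar> * s m = \<bar>(1 / s m - 1) * s m\<bar>" using pos by (simp add: abs_mult)
      also have "(1 / s m - 1) * s m = 1 - s m" using pos by (simp add: field_simps)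
      finally show ?thesis .
    qed
    finally show ?thesis by (simp add: C_def)
  qed
  show "(\<lambda>m. expectation (\<lambda>\<omega>. \<bar>(W m \<omega> - expectation (W m)) / sqrt (variance (W m)) - B m \<omega>\<bar>)) \<longlonglongrightarrow> 0"
  proof (rule Lim_null_comparison)
    have "\<forall>\<^sub>F m in sequentially. s m > 0" using order_tendstoD(1)[OF s1, of 0] by simp
    then show "\<forall>\<^sub>F m in sequentially. norm (expectation (\<lambda>\<omega>. \<bar>(W m \<omega> - expectation (W m)) / sqrt (variance (W m)) - B m \<omega>\<bar>))
        \<le> \<bar>1 - s m\<bar> + 2 * sqrt (v m)"
      by eventually_elim (use bound in \<open>simp add: s_def\<close>)
    have "(\<lambda>m. \<bar>1 - s m\<bar> + 2 * sqrt (v m)) \<longlonglongrightarrow> \<bar>1 - 1\<bar> + 2 * sqrt 0"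
      by (intro tendsto_intros s1 v0)
    then show "(\<lambda>m. \<bar>1 - s m\<bar> + 2 * sqrt (v m)) \<longlonglongrightarrow> 0" by simp
  qed
qed

section \<open>Sums of independent variables\<close>

lemma (in prob_space) indep_vars_reindex:
  assumes indep: "indep_vars N X (f ` I)" and inj: "inj_on f I"
  shows "indep_vars (\<lambda>i. N (f i)) (\<lambda>i. X (f i)) I"
  unfolding indep_vars_def2
proof (intro conjI ballI indep_setsI)
  have rv: "random_variable (N j) (X j)" if "j \<in> f ` I" for j
    using indep that by (auto simp: indep_vars_def2)
  then show "random_variable (N (f i)) (X (f i))" if "i \<in> I" for i using that by blast
  show "{X (f i) -` A \<inter> space M |A. A \<in> sets (N (f i))} \<subseteq> events" if "i \<in> I" for i
    using rv[of "f i"] that by (auto intro: measurable_sets)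
  fix A J
  assume J: "J \<noteq> {}" "J \<subseteq> I" "finite J"
    and A: "\<forall>j\<in>J. A j \<in> {X (f j) -` A \<inter> space M |A. A \<in> sets (N (f j))}"
  define A' where "A' = A \<circ> the_inv_into J f"
  have injJ: "inj_on f J" using inj J(2) by (rule inj_on_subset)
  then have A': "A' (f j) = A j" if "j \<in> J" for j
    using that by (simp add: A'_def the_inv_into_f_f)
  have "indep_sets (\<lambda>i. {X i -` A \<inter> space M |A. A \<in> sets (N i)}) (f ` I)"
    using indep by (simp add: indep_vars_def2)
  then have "prob (\<Inter>j\<in>f ` J. A' j) = (\<Prod>j\<in>f ` J. prob (A' j))"
    by (rule indep_setsD) (use J A A' in auto)
  then show "prob (\<Inter>j\<in>J. A j) = (\<Prod>j\<in>J. prob (A j))"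
    using A' by (simp add: prod.reindex[OF injJ])
qed

lemma (in prob_space) square_integrable_sum:
  fixes Y :: "nat \<Rightarrow> 'a \<Rightarrow> real"
  assumes [measurable]: "\<And>i. Y i \<in> borel_measurable M" and "\<And>i. integrable M (\<lambda>\<omega>. (Y i \<omega>)\<^sup>2)"
  shows "integrable M (\<lambda>\<omega>. (\<Sum>i<m. Y i \<omega>)\<^sup>2)"
proof (induction m)
  case (Suc m)
  then show ?case using square_integrable_add[of "\<lambda>\<omega>. \<Sum>i<m. Y i \<omega>" M "Y m"] assms by simp
qed simp

lemma (in prob_space) second_moment_sum:
  fixes Y :: "nat \<Rightarrow> 'a \<Rightarrow> real"
  assumes indep: "indep_vars (\<lambda>_. borel) Y UNIV"
    and Y2: "\<And>i. integrable M (\<lambda>\<omega>. (Y i \<omega>)\<^sup>2)" and mean: "\<And>i. expectation (Y i) = 0"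
  shows "expectation (\<lambda>\<omega>. (\<Sum>i<m. Y i \<omega>)\<^sup>2) = (\<Sum>i<m. expectation (\<lambda>\<omega>. (Y i \<omega>)\<^sup>2))"
proof (induction m)
  case (Suc m)
  define S where "S = (\<lambda>\<omega>. \<Sum>i<m. Y i \<omega>)"
  have [measurable]: "Y i \<in> borel_measurable M" for i
    using indep by (auto simp: indep_vars_def2)
  have YI: "integrable M (Y i)" for i
    using square_integrable_imp_integrable[OF _ Y2] by simp
  have SI: "integrable M S" using YI by (simp add: S_def)
  have S2: "integrable M (\<lambda>\<omega>. (S \<omega>)\<^sup>2)"
    unfolding S_def by (rule square_integrable_sum) (use Y2 in auto)
  have "indep_var borel (Y m) borel S"
    unfolding S_def by (rule indep_vars_sum) (auto intro: indep_vars_subset[OF indep])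
  note prod = indep_var_integrable[OF this YI SI] indep_var_lebesgue_integral[OF this YI SI]
  have "expectation (\<lambda>\<omega>. (S \<omega> + Y m \<omega>)\<^sup>2) = expectation (\<lambda>\<omega>. (S \<omega>)\<^sup>2 + 2 * (Y m \<omega> * S \<omega>) + (Y m \<omega>)\<^sup>2)"
    by (simp add: power2_eq_square algebra_simps)
  also have "\<dots> = expectation (\<lambda>\<omega>. (S \<omega>)\<^sup>2) + expectation (\<lambda>\<omega>. (Y m \<omega>)\<^sup>2)"
    using S2 Y2 prod mean by simp
  finally show ?case using Suc by (simp add: S_def)
qed (simp add: prob_space)

text \<open>Fourth moments of centered sums grow like \<open>m\<^sup>2\<close>, not like \<open>m ^ 4\<close>: in the binomial expansion of
\<open>(S + W) ^ 4\<close> the terms that are linear in \<open>S\<close> or in \<open>W\<close> have mean zero, and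
\<open>3 * m\<^sup>2 + 6 * m + 1 \<le> 3 * (m + 1)\<^sup>2\<close>.
This makes the quadratic remainder \<open>(N - \<mu>)\<^sup>2\<close> of a count negligible in \<open>L\<^sup>2\<close>.\<close>

lemma (in prob_space) fourth_moment_sum_le:
  fixes W :: "nat \<Rightarrow> 'a \<Rightarrow> real"
  assumes indep: "indep_vars (\<lambda>_. borel) W UNIV"
    and bound: "\<And>i \<omega>. \<bar>W i \<omega>\<bar> \<le> 1" and mean: "\<And>i. expectation (W i) = 0"
  shows "expectation (\<lambda>\<omega>. (\<Sum>i<m. W i \<omega>) ^ 4) \<le> 3 * (real m)\<^sup>2"
proof (induction m)
  case (Suc m)
  define S where "S = (\<lambda>\<omega>. \<Sum>i<m. W i \<omega>)"
  have [measurable]: "W i \<in> borel_measurable M" for i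
    using indep by (auto simp: indep_vars_def2)
  have [measurable]: "S \<in> borel_measurable M" by (simp add: S_def)
  have S_le: "\<bar>S \<omega>\<bar> \<le> real m" for \<omega>
    using order_trans[OF sum_abs sum_bounded_above[of "{..<m}" "\<lambda>i. \<bar>W i \<omega>\<bar>" 1]] bound
    by (simp add: S_def)
  have W_pow: "\<bar>W i \<omega> ^ a\<bar> \<le> 1" for i a \<omega>
    by (simp add: power_abs bound power_le_one)
  have WI: "integrable M (\<lambda>\<omega>. W i \<omega> ^ a)" for i a
    by (rule integrable_const_bound[where B=1]) (simp_all only: W_pow real_norm_def eventually_True, simp)
  have SI: "integrable M (\<lambda>\<omega>. S \<omega> ^ b)" for b
    by (rule integrable_const_bound[where B="real m ^ b"]) (auto simp: power_abs S_le intro!: power_mono)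
  have W_le_1: "expectation (\<lambda>\<omega>. W i \<omega> ^ a) \<le> 1" for i a
  proof -
    have "expectation (\<lambda>\<omega>. W i \<omega> ^ a) \<le> expectation (\<lambda>_. 1)"
      by (intro integral_mono WI) (use abs_le_D1[OF W_pow] in auto)
    then show ?thesis by (simp add: prob_space)
  qed
  have S1: "expectation S = 0" using WI[of _ 1] mean by (simp add: S_def)
  have "expectation (\<lambda>\<omega>. (S \<omega>)\<^sup>2) = (\<Sum>i<m. expectation (\<lambda>\<omega>. (W i \<omega>)\<^sup>2))"
    unfolding S_def by (rule second_moment_sum[OF indep WI mean])
  also have "\<dots> \<le> real m" using sum_bounded_above[of "{..<m}" _ "1::real"] W_le_1 by simp
  finally have S2: "expectation (\<lambda>\<omega>. (S \<omega>)\<^sup>2) \<le> real m" .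
  have "indep_var borel (W m) borel S"
    unfolding S_def by (rule indep_vars_sum) (auto intro: indep_vars_subset[OF indep])
  then have "indep_var borel ((\<lambda>x. x ^ a) \<circ> W m) borel ((\<lambda>x. x ^ b) \<circ> S)" for a b
    by (rule indep_var_compose) auto
  then have iv: "indep_var borel (\<lambda>\<omega>. W m \<omega> ^ a) borel (\<lambda>\<omega>. S \<omega> ^ b)" for a b
    by (simp add: comp_def)
  note int = indep_var_integrable[OF iv WI SI] and prod = indep_var_lebesgue_integral[OF iv WI SI]
  have "expectation (\<lambda>\<omega>. (S \<omega> + W m \<omega>) ^ 4)
      = expectation (\<lambda>\<omega>. S \<omega> ^ 4 + 4 * (W m \<omega> ^ 1 * S \<omega> ^ 3) + 6 * (W m \<omega> ^ 2 * S \<omega> ^ 2)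
          + 4 * (W m \<omega> ^ 3 * S \<omega> ^ 1) + W m \<omega> ^ 4)"
    by (intro Bochner_Integration.integral_cong refl) (simp add: power4_eq_xxxx power3_eq_cube power2_eq_square algebra_simps)
  also have "\<dots> = expectation (\<lambda>\<omega>. S \<omega> ^ 4) + 4 * expectation (\<lambda>\<omega>. W m \<omega> ^ 1 * S \<omega> ^ 3)
      + 6 * expectation (\<lambda>\<omega>. W m \<omega> ^ 2 * S \<omega> ^ 2) + 4 * expectation (\<lambda>\<omega>. W m \<omega> ^ 3 * S \<omega> ^ 1)
      + expectation (\<lambda>\<omega>. W m \<omega> ^ 4)"
    using SI[of 4] WI[of m 4] int[of 1 3] int[of 2 2] int[of 3 1] by simp
  also have "\<dots> = expectation (\<lambda>\<omega>. S \<omega> ^ 4)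
      + 6 * (expectation (\<lambda>\<omega>. (W m \<omega>)\<^sup>2) * expectation (\<lambda>\<omega>. (S \<omega>)\<^sup>2)) + expectation (\<lambda>\<omega>. W m \<omega> ^ 4)"
    unfolding prod by (simp add: mean S1)
  also have "\<dots> \<le> 3 * (real m)\<^sup>2 + 6 * (1 * real m) + 1"
    using Suc S2 W_le_1 by (intro add_mono mult_left_mono mult_mono) (auto simp: S_def)
  also have "\<dots> \<le> 3 * (real (Suc m))\<^sup>2" by (simp add: power2_eq_square algebra_simps)
  finally show ?case by (simp add: S_def)
qed simp

text \<open>The sum of \<open>m\<close> terms has standard deviation \<open>\<sigma> * \<surd>m\<close>, so an \<open>L\<^sup>2\<close> error of order \<open>c m\<close> is smaller than the
standard deviation of \<open>c m\<close> times the sum by a factor \<open>\<surd>m\<close>. The affine normalization by \<open>a m\<close> and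
\<open>c m\<close> cancels in the standardization of \<open>Z m\<close>.\<close>

lemma (in prob_space) asymptotic_normality_of_perturbed_iid_sum:
  fixes Y Z :: "nat \<Rightarrow> 'a \<Rightarrow> real" and a c :: "nat \<Rightarrow> real"
  assumes indep: "indep_vars (\<lambda>_. borel) Y UNIV" and ident: "\<And>i. distr M borel (Y i) = \<mu>"
    and Y2: "\<And>i. integrable M (\<lambda>\<omega>. (Y i \<omega>)\<^sup>2)" and mean: "\<And>i. expectation (Y i) = 0"
    and \<sigma>: "\<sigma> > 0" "\<And>i. expectation (\<lambda>\<omega>. (Y i \<omega>)\<^sup>2) = \<sigma>\<^sup>2"
    and Z[measurable]: "\<And>m. Z m \<in> borel_measurable M" and Z2: "\<And>m. integrable M (\<lambda>\<omega>. (Z m \<omega>)\<^sup>2)"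
    and c: "\<And>m. m > 0 \<Longrightarrow> c m > 0"
    and err: "\<And>m. m > 0 \<Longrightarrow>
      expectation (\<lambda>\<omega>. (Z m \<omega> - a m - c m * (\<Sum>i<m. Y i \<omega>))\<^sup>2) \<le> K * (c m)\<^sup>2"
  shows "weak_conv_m
    (\<lambda>m. distr M borel (\<lambda>\<omega>. (Z m \<omega> - expectation (Z m)) / sqrt (variance (Z m)))) std_normal_distribution"
proof -
  have [measurable]: "Y i \<in> borel_measurable M" for i
    using indep by (auto simp: indep_vars_def2)
  have YI: "integrable M (Y i)" for i
    using square_integrable_imp_integrable[OF _ Y2] by simp
  have ZI: "integrable M (Z m)" for m
    using square_integrable_imp_integrable[OF _ Z2] by simp
  define S where "S m \<omega> = (\<Sum>i<m. Y i \<omega>)" for m \<omega>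
  have [measurable]: "S m \<in> borel_measurable M" for m by (simp add: S_def[abs_def])
  have S2: "integrable M (\<lambda>\<omega>. (S m \<omega>)\<^sup>2)" for m
    unfolding S_def by (rule square_integrable_sum) (use Y2 in auto)
  define h where "h m = sqrt (real m * \<sigma>\<^sup>2)" for m
  have h: "h m > 0" if "m > 0" for m using that \<sigma> by (simp add: h_def)
  have h2: "(h m)\<^sup>2 = real m * \<sigma>\<^sup>2" for m by (simp add: h_def)
  \<comment> \<open>The value at \<open>m = 0\<close> only keeps \<open>k\<close> positive, so that standardizing \<open>W m\<close> and \<open>Z m\<close> is the same for every \<open>m\<close>.\<close>
  define k where "k m = (if m = 0 then 1 else c m * h m)" for m
  have k: "k m > 0" for m using c h by (simp add: k_def)
  define B where "B m \<omega> = S m \<omega> / h m" for m \<omega>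
  define W where "W m \<omega> = (Z m \<omega> - a m) / k m" for m \<omega>
  have conv: "weak_conv_m (\<lambda>m. distr M borel (B m)) std_normal_distribution"
    unfolding B_def[abs_def] S_def h_def
    by (rule central_limit_theorem_zero_mean[OF indep mean \<sigma>(1) Y2 _ ident]) (simp add: mean \<sigma>)
  have "weak_conv_m (\<lambda>m. distr M borel (\<lambda>\<omega>. (W m \<omega> - expectation (W m)) / sqrt (variance (W m))))
      std_normal_distribution"
  proof (rule standardization_weak_conv[OF _ _ _ _ _ _ _ conv real_dist_normal_dist])
    show "W m \<in> borel_measurable M" "B m \<in> borel_measurable M" for m
      by (simp_all add: W_def[abs_def] B_def[abs_def])
    show "integrable M (\<lambda>\<omega>. (W m \<omega>)\<^sup>2)" for m
      using Z2 ZI by (simp add: W_def power_divide power2_diff)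
    show "integrable M (\<lambda>\<omega>. (B m \<omega>)\<^sup>2)" for m
      using S2 by (simp add: B_def power_divide)
    show "expectation (B m) = 0" for m
      using YI mean by (simp add: B_def[abs_def] S_def)
    have "expectation (\<lambda>\<omega>. (S m \<omega>)\<^sup>2) = real m * \<sigma>\<^sup>2" for m
      unfolding S_def using second_moment_sum[OF indep Y2 mean] \<sigma>(2) by simp
    then have "expectation (\<lambda>\<omega>. (B m \<omega>)\<^sup>2) = 1" if "m > 0" for m
      using that \<sigma>(1) by (simp add: B_def power_divide h2)
    then show "\<forall>\<^sub>F m in sequentially. expectation (\<lambda>\<omega>. (B m \<omega>)\<^sup>2) = 1"
      by (rule eventually_mono[OF eventually_gt_at_top[of 0]])
    show "(\<lambda>m. expectation (\<lambda>\<omega>. (W m \<omega> - B m \<omega>)\<^sup>2)) \<longlonglongrightarrow> 0"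
    proof (rule Lim_null_comparison)
      show "(\<lambda>m. K / \<sigma>\<^sup>2 * inverse (real m)) \<longlonglongrightarrow> 0"
        using tendsto_mult_right_zero[OF lim_inverse_n] .
      have "expectation (\<lambda>\<omega>. (W m \<omega> - B m \<omega>)\<^sup>2) \<le> K / \<sigma>\<^sup>2 * inverse (real m)" if m: "m > 0" for m
      proof -
        have "W m \<omega> - B m \<omega> = (Z m \<omega> - a m - c m * S m \<omega>) / k m" for \<omega>
          using m c[OF m] h[OF m] by (simp add: W_def B_def k_def field_simps)
        then have "expectation (\<lambda>\<omega>. (W m \<omega> - B m \<omega>)\<^sup>2)
            = expectation (\<lambda>\<omega>. (Z m \<omega> - a m - c m * S m \<omega>)\<^sup>2) / (k m)\<^sup>2"
          by (simp add: power_divide)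
        also have "\<dots> \<le> K * (c m)\<^sup>2 / (k m)\<^sup>2"
          using err[OF m] by (intro divide_right_mono) (auto simp: S_def)
        also have "\<dots> = K / \<sigma>\<^sup>2 * inverse (real m)"
          using m c[OF m] by (simp add: k_def power_mult_distrib h2 field_simps)
        finally show ?thesis .
      qed
      then show "\<forall>\<^sub>F m in sequentially. norm (expectation (\<lambda>\<omega>. (W m \<omega> - B m \<omega>)\<^sup>2)) \<le> K / \<sigma>\<^sup>2 * inverse (real m)"
        by (intro eventually_mono[OF eventually_gt_at_top[of 0]]) simp
    qed
  qed
  also have "(\<lambda>m. distr M borel (\<lambda>\<omega>. (W m \<omega> - expectation (W m)) / sqrt (variance (W m))))
      = (\<lambda>m. distr M borel (\<lambda>\<omega>. (Z m \<omega> - expectation (Z m)) / sqrt (variance (Z m))))"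
  proof
    fix m
    have EW: "expectation (W m) = (expectation (Z m) - a m) / k m"
      using ZI by (simp add: W_def[abs_def] prob_space)
    have cent: "W m \<omega> - expectation (W m) = (Z m \<omega> - expectation (Z m)) / k m" for \<omega>
      unfolding EW by (simp add: W_def diff_divide_distrib)
    have "sqrt (variance (W m)) = sqrt (variance (Z m)) / k m"
      unfolding cent using k[of m] by (simp add: power_divide real_sqrt_divide)
    then show "distr M borel (\<lambda>\<omega>. (W m \<omega> - expectation (W m)) / sqrt (variance (W m)))
      = distr M borel (\<lambda>\<omega>. (Z m \<omega> - expectation (Z m)) / sqrt (variance (Z m)))"
      unfolding cent using k[of m] by simp
  qed
  finally show ?thesis .
qed

section \<open>Linearization of binomial coefficients\<close>

text \<open>Taylor's formula of order two. The induction avoids derivatives: with \<open>R k\<close> the remainder,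
\<open>R (k + 1) = x * R k + (k + 2) * y ^ (k + 1) * (x - y)\<^sup>2\<close>.\<close>

lemma power_linearization_error:
  fixes x y c :: real
  assumes "0 \<le> x" "x \<le> c" "0 \<le> y" "y \<le> c"
  shows "\<bar>x ^ (k + 2) - y ^ (k + 2) - real (k + 2) * y ^ (k + 1) * (x - y)\<bar>
      \<le> (real (k + 2))\<^sup>2 * c ^ k * (x - y)\<^sup>2"
proof (induction k)
  case 0
  have "x\<^sup>2 - y\<^sup>2 - 2 * y * (x - y) = (x - y)\<^sup>2" by (simp add: power2_eq_square algebra_simps)
  then show ?case by (simp add: numeral_2_eq_2[symmetric])
next
  case (Suc k)
  define R where "R k = x ^ (k + 2) - y ^ (k + 2) - real (k + 2) * y ^ (k + 1) * (x - y)" for k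
  have "R (Suc k) = x * R k + real (k + 2) * y ^ (k + 1) * (x - y)\<^sup>2"
    by (simp add: R_def power2_eq_square algebra_simps)
  then have "\<bar>R (Suc k)\<bar> \<le> \<bar>x * R k\<bar> + \<bar>real (k + 2) * y ^ (k + 1) * (x - y)\<^sup>2\<bar>"
    by (metis abs_triangle_ineq)
  also have "\<dots> = x * \<bar>R k\<bar> + real (k + 2) * y ^ (k + 1) * (x - y)\<^sup>2"
    using assms by (simp add: abs_mult)
  also have "\<dots> \<le> c * ((real (k + 2))\<^sup>2 * c ^ k * (x - y)\<^sup>2) + real (k + 2) * c ^ (k + 1) * (x - y)\<^sup>2"
    using assms Suc unfolding R_def[symmetric]
    by (intro add_mono mult_mono[OF \<open>x \<le> c\<close>] mult_right_mono mult_left_mono power_mono) auto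
  also have "\<dots> = ((real (k + 2))\<^sup>2 + real (k + 2)) * (c ^ Suc k * (x - y)\<^sup>2)"
    by (simp add: algebra_simps)
  also have "\<dots> \<le> (real (Suc k + 2))\<^sup>2 * (c ^ Suc k * (x - y)\<^sup>2)"
  proof (rule mult_right_mono)
    show "(real (k + 2))\<^sup>2 + real (k + 2) \<le> (real (Suc k + 2))\<^sup>2"
      by (simp add: power2_eq_square algebra_simps)
  qed (use assms in simp)
  finally show ?case by (simp add: R_def mult.assoc)
qed

text \<open>The recursion of the falling factorial \<open>N (N - 1) \<dots> (N - k + 1)\<close>, in the reals so that no
truncated subtraction occurs; both sides vanish for \<open>N < k\<close>.\<close>

lemma fact_times_binomial_Suc:
  "fact (Suc k) * real (N choose Suc k) = (real N - real k) * (fact k * real (N choose k))"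
proof (cases "k \<le> N")
  case True
  have "Suc k * (N choose Suc k) = (N - k) * (N choose k)"
    by (metis binomial_absorb_comp binomial_absorption mult.commute)
  then have "real (Suc k * (N choose Suc k)) = real ((N - k) * (N choose k))" by simp
  then have "real (Suc k) * real (N choose Suc k) = (real N - real k) * real (N choose k)"
    using True by (simp only: of_nat_mult of_nat_diff)
  then have "fact k * (real (Suc k) * real (N choose Suc k)) = fact k * ((real N - real k) * real (N choose k))"
    by (rule arg_cong)
  then show ?thesis by (simp only: fact_Suc of_nat_mult of_nat_fact ac_simps)
qed (simp add: binomial_eq_0)

lemma fact_times_binomial_le_power:
  assumes "N \<le> m"
  shows "fact k * real (N choose k) \<le> real m ^ k"
proof (induction k)
  case (Suc k)
  show ?case
  proof (cases "k \<le> N")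
    case True
    then show ?thesis unfolding fact_times_binomial_Suc power_Suc
      using Suc assms by (intro mult_mono) auto
  qed (simp add: binomial_eq_0)
qed simp

lemma falling_factorial_error:
  assumes "N \<le> m"
  shows "\<bar>fact (k + 1) * real (N choose (k + 1)) - real N ^ (k + 1)\<bar> \<le> (real (k + 1))\<^sup>2 * real m ^ k"
proof (induction k)
  case (Suc k)
  define F where "F k = fact k * real (N choose k)" for k
  have "F (k + 2) - real N ^ (k + 2) = real N * (F (k + 1) - real N ^ (k + 1)) - real (k + 1) * F (k + 1)"
    using fact_times_binomial_Suc[of "k + 1" N] by (simp add: F_def algebra_simps)
  then have "\<bar>F (k + 2) - real N ^ (k + 2)\<bar>
      \<le> \<bar>real N * (F (k + 1) - real N ^ (k + 1))\<bar> + \<bar>real (k + 1) * F (k + 1)\<bar>"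
    by (metis abs_triangle_ineq4)
  also have "\<dots> = real N * \<bar>F (k + 1) - real N ^ (k + 1)\<bar> + real (k + 1) * F (k + 1)"
    by (simp add: abs_mult F_def)
  also have "\<dots> \<le> real m * ((real (k + 1))\<^sup>2 * real m ^ k) + real (k + 1) * real m ^ (k + 1)"
    using Suc fact_times_binomial_le_power[OF assms, of "k + 1"] assms
    by (intro add_mono mult_mono) (auto simp: F_def)
  also have "\<dots> = ((real (k + 1))\<^sup>2 + real (k + 1)) * real m ^ (k + 1)" by (simp add: algebra_simps)
  also have "\<dots> \<le> (real (k + 2))\<^sup>2 * real m ^ (k + 1)"
    by (intro mult_right_mono) (auto simp: power2_eq_square algebra_simps)
  finally show ?case by (simp add: F_def)
qed simp

text \<open>If \<open>N\<close> deviates from \<open>\<mu>\<close> by about \<open>\<surd>m\<close>, as binomial counts do, then the linear term is of order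
\<open>m ^ (k + 3/2)\<close> while the error bound is only of order \<open>m ^ (k + 1)\<close>.\<close>

lemma binomial_linearization_error:
  fixes \<mu> :: real
  assumes N: "N \<le> m" and \<mu>: "0 \<le> \<mu>" "\<mu> \<le> real m"
  shows "\<bar>fact (k + 2) * real (N choose (k + 2)) - \<mu> ^ (k + 2) - real (k + 2) * \<mu> ^ (k + 1) * (real N - \<mu>)\<bar>
    \<le> (real (k + 2))\<^sup>2 * real m ^ k * (real m + (real N - \<mu>)\<^sup>2)"
proof -
  have "\<bar>fact (k + 2) * real (N choose (k + 2)) - real N ^ (k + 2)\<bar> \<le> (real (k + 2))\<^sup>2 * real m ^ (k + 1)"
    using falling_factorial_error[OF N, of "k + 1"] by simp
  moreover have "\<bar>real N ^ (k + 2) - \<mu> ^ (k + 2) - real (k + 2) * \<mu> ^ (k + 1) * (real N - \<mu>)\<bar>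
      \<le> (real (k + 2))\<^sup>2 * real m ^ k * (real N - \<mu>)\<^sup>2"
    by (rule power_linearization_error) (use N \<mu> in auto)
  moreover have "(real (k + 2))\<^sup>2 * real m ^ k * (real m + (real N - \<mu>)\<^sup>2)
      = (real (k + 2))\<^sup>2 * real m ^ (k + 1) + (real (k + 2))\<^sup>2 * real m ^ k * (real N - \<mu>)\<^sup>2"
    by (simp add: algebra_simps)
  ultimately show ?thesis by linarith
qed

section \<open>Polynomials in binomially distributed counts\<close>

lemma measurable_card_hits:
  fixes m :: nat
  assumes V: "\<And>i. V i \<in> measurable M (count_space UNIV)"
  shows "(\<lambda>\<omega>. card {i\<in>{..<m}. P (V i \<omega>)}) \<in> measurable M (count_space UNIV)"
proof -
  have [measurable]: "(\<lambda>\<omega>. of_bool (P (V i \<omega>)) :: nat) \<in> measurable M (count_space UNIV)" for i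
    by (rule measurable_compose[OF V]) simp
  have "(\<lambda>\<omega>. \<Sum>i<m. of_bool (P (V i \<omega>)) :: nat) \<in> measurable M (count_space UNIV)"
    by (induction m) simp_all
  moreover have "card {i\<in>{..<m}. P (V i \<omega>)} = (\<Sum>i<m. of_bool (P (V i \<omega>)))" for \<omega>
    by (simp add: Int_def)
  ultimately show ?thesis by (simp only:)
qed

text \<open>The number \<open>N\<close> of indices below \<open>m\<close> for which \<open>P d\<close> holds is a sum of independent indicators with mean
\<open>m * p d\<close>. Linearizing each \<open>N choose (k + 2)\<close> at this mean leaves a constant plus a multiple of a sum of
i.i.d. variables \<open>g (V i)\<close>, with an \<open>L\<^sup>2\<close> error of order \<open>m ^ (k + 1)\<close>, the size of a single term of that
sum. The function \<open>g\<close> is, up to a constant factor, the first-order projection in Hoeffding's sense, and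
the limit is normal as soon as it does not vanish almost surely.\<close>

lemma (in prob_space) asymptotic_normality_of_binomials_of_counts:
  fixes V :: "nat \<Rightarrow> 'a \<Rightarrow> 'b" and P :: "'d \<Rightarrow> 'b \<Rightarrow> bool" and J :: "'d \<Rightarrow> real" and k :: nat
  assumes V: "indep_vars (\<lambda>_. count_space UNIV) V UNIV"
    and ident: "\<And>i. distr M (count_space UNIV) (V i) = \<nu>" and D: "finite D"
  defines "p \<equiv> \<lambda>d. measure \<nu> {x. P d x}"
  defines "g \<equiv> \<lambda>x. \<Sum>d\<in>D. J d * p d ^ (k + 1) * (of_bool (P d x) - p d)"
  defines "Z \<equiv> \<lambda>m \<omega>. \<Sum>d\<in>D. J d * real (card {i\<in>{..<m}. P d (V i \<omega>)} choose (k + 2))"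
  assumes nondeg: "(\<integral>x. (g x)\<^sup>2 \<partial>\<nu>) > 0"
  shows "weak_conv_m
    (\<lambda>m. distr M borel (\<lambda>\<omega>. (Z m \<omega> - expectation (Z m)) / sqrt (variance (Z m)))) std_normal_distribution"
proof -
  have rv[measurable]: "V i \<in> measurable M (count_space UNIV)" for i
    using V by (auto simp: indep_vars_def2)
  have sets_\<nu>: "sets \<nu> = UNIV" and space_\<nu>: "space \<nu> = UNIV"
    unfolding ident[of 0, symmetric] by simp_all
  interpret \<nu>: prob_space \<nu>
    unfolding ident[of 0, symmetric] by (rule prob_space_distr) simp
  have fV[measurable]: "(\<lambda>\<omega>. f (V i \<omega>)) \<in> borel_measurable M" for f :: "'b \<Rightarrow> real" and i
    by (rule measurable_compose[OF rv]) simp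
  have E_V: "expectation (\<lambda>\<omega>. f (V i \<omega>)) = (\<integral>x. f x \<partial>\<nu>)" for f :: "'b \<Rightarrow> real" and i
    unfolding ident[of i, symmetric] by (rule integral_distr[symmetric]) simp_all
  have indep_f: "indep_vars (\<lambda>_. borel) (\<lambda>i \<omega>. f (V i \<omega>)) UNIV" for f :: "'b \<Rightarrow> real"
    using indep_vars_compose2[OF V, of "\<lambda>_. f"] by simp
  have p01: "0 \<le> p d" "p d \<le> 1" for d by (simp_all add: p_def)
  have E_P: "(\<integral>x. of_bool (P d x) \<partial>\<nu>) = p d" for d
  proof -
    have "(\<integral>x. of_bool (P d x) \<partial>\<nu>) = (\<integral>x. (indicator {x. P d x} x :: real) \<partial>\<nu>)"
      by (intro Bochner_Integration.integral_cong) (auto simp: indicator_def)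
    then show ?thesis by (simp add: p_def space_\<nu>)
  qed
  have \<nu>_meas[measurable]: "f \<in> borel_measurable \<nu>" for f :: "'b \<Rightarrow> real"
    by (auto simp: measurable_def sets_\<nu>)
  have P_int: "integrable \<nu> (\<lambda>x. of_bool (P d x) :: real)" for d
    by (rule \<nu>.integrable_const_bound[where B=1]) auto

  define U where "U d i \<omega> = of_bool (P d (V i \<omega>)) - p d" for d i \<omega>
  have U_le: "\<bar>U d i \<omega>\<bar> \<le> 1" for d i \<omega> using p01[of d] by (auto simp: U_def)
  have U_mean: "expectation (U d i) = 0" for d i
    using E_V[of "\<lambda>x. of_bool (P d x) - p d" i] P_int E_P by (simp add: U_def[abs_def] \<nu>.prob_space)
  have U_meas[measurable]: "U d i \<in> borel_measurable M" for d i
    unfolding U_def[abs_def] by (rule fV)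
  have U_indep: "indep_vars (\<lambda>_. borel) (U d) UNIV" for d
    unfolding U_def[abs_def] by (rule indep_f)
  define T where "T d m \<omega> = (\<Sum>i<m. U d i \<omega>)" for d m \<omega>
  have T_meas[measurable]: "T d m \<in> borel_measurable M" for d m
    by (simp add: T_def[abs_def])
  have T_le: "\<bar>T d m \<omega>\<bar> \<le> real m" for d m \<omega>
    using order_trans[OF sum_abs sum_bounded_above[of "{..<m}" "\<lambda>i. \<bar>U d i \<omega>\<bar>" 1]] U_le
    by (simp add: T_def)
  have T4_int: "integrable M (\<lambda>\<omega>. T d m \<omega> ^ 4)" for d m
  proof (rule integrable_const_bound[where B="real m ^ 4"])
    have "\<bar>T d m \<omega> ^ 4\<bar> \<le> real m ^ 4" for \<omega>
      unfolding power_abs by (intro power_mono T_le abs_ge_zero)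
    then show "AE \<omega> in M. norm (T d m \<omega> ^ 4) \<le> real m ^ 4" by simp
  qed simp
  have T4: "expectation (\<lambda>\<omega>. T d m \<omega> ^ 4) \<le> 3 * (real m)\<^sup>2" for d m
    unfolding T_def by (rule fourth_moment_sum_le[OF U_indep U_le U_mean])

  define N where "N d m \<omega> = card {i\<in>{..<m}. P d (V i \<omega>)}" for d m \<omega>
  have N_le: "N d m \<omega> \<le> m" for d m \<omega>
    unfolding N_def using card_mono[of "{..<m}" "{i\<in>{..<m}. P d (V i \<omega>)}"] by auto
  have N_sum: "real (N d m \<omega>) = (\<Sum>i<m. of_bool (P d (V i \<omega>)))" for d m \<omega>
    by (simp add: N_def sum_of_bool_eq Int_def)
  have N_T: "real (N d m \<omega>) - real m * p d = T d m \<omega>" for d m \<omega>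
    unfolding N_sum by (simp add: T_def U_def sum_subtractf)
  have N_meas[measurable]: "N d m \<in> measurable M (count_space UNIV)" for d m
    unfolding N_def[abs_def] by (rule measurable_card_hits) (rule rv)
  define r where "r = k + 2"
  have Z_eq: "Z m \<omega> = (\<Sum>d\<in>D. J d * real (N d m \<omega> choose r))" for m \<omega>
    by (simp add: Z_def N_def r_def)
  have Z_meas[measurable]: "Z m \<in> borel_measurable M" for m
    unfolding Z_eq[abs_def] by measurable
  have Z2: "integrable M (\<lambda>\<omega>. (Z m \<omega>)\<^sup>2)" for m
  proof (rule integrable_const_bound[where B="(\<Sum>d\<in>D. \<bar>J d\<bar> * real (m choose r))\<^sup>2"])
    have "\<bar>Z m \<omega>\<bar> \<le> (\<Sum>d\<in>D. \<bar>J d\<bar> * real (m choose r))" for \<omega>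
      unfolding Z_eq
      by (intro order_trans[OF sum_abs] sum_mono)
        (auto simp: abs_mult intro!: mult_left_mono binomial_right_mono N_le)
    then show "AE \<omega> in M. norm ((Z m \<omega>)\<^sup>2) \<le> (\<Sum>d\<in>D. \<bar>J d\<bar> * real (m choose r))\<^sup>2"
      by (auto simp: power2_le_iff_abs_le sum_nonneg)
  qed simp

  define Y where "Y i \<omega> = g (V i \<omega>)" for i \<omega>
  have Y_U: "Y i \<omega> = (\<Sum>d\<in>D. J d * p d ^ (k + 1) * U d i \<omega>)" for i \<omega>
    by (simp add: Y_def g_def U_def)
  define \<sigma> where "\<sigma> = sqrt (\<integral>x. (g x)\<^sup>2 \<partial>\<nu>)"
  \<comment> \<open>The remainder in the linearization of the falling factorial of \<open>N\<close> at \<open>m * p d\<close>.\<close>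
  define R where "R d m \<omega> = fact r * real (N d m \<omega> choose r) - (real m * p d) ^ r
      - real r * (real m * p d) ^ (k + 1) * T d m \<omega>" for d m \<omega>
  have R_le: "\<bar>R d m \<omega>\<bar> \<le> (real r)\<^sup>2 * real m ^ k * (real m + (T d m \<omega>)\<^sup>2)" for d m \<omega>
    unfolding R_def r_def N_T[symmetric]
    by (rule binomial_linearization_error) (use N_le p01 in \<open>auto intro: mult_left_le\<close>)
  have R2_le: "(R d m \<omega>)\<^sup>2 \<le> real r ^ 4 * real m ^ (2 * k) * (2 * (real m)\<^sup>2 + 2 * T d m \<omega> ^ 4)" for d m \<omega>
  proof -
    have "(R d m \<omega>)\<^sup>2 \<le> ((real r)\<^sup>2 * real m ^ k * (real m + (T d m \<omega>)\<^sup>2))\<^sup>2"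
      using power_mono[OF R_le abs_ge_zero, of d m \<omega> 2] by simp
    also have "\<dots> = real r ^ 4 * real m ^ (2 * k) * (real m + (T d m \<omega>)\<^sup>2)\<^sup>2"
      by (simp add: power_mult_distrib flip: power_mult) (simp add: mult.commute)
    also have "\<dots> \<le> real r ^ 4 * real m ^ (2 * k) * (2 * (real m)\<^sup>2 + 2 * T d m \<omega> ^ 4)"
      using sum_squares_bound[of "real m" "(T d m \<omega>)\<^sup>2"]
      by (intro mult_left_mono) (simp_all add: power2_sum flip: power_mult)
    finally show ?thesis .
  qed

  define a where "a m = (\<Sum>d\<in>D. J d * (real m * p d) ^ r / fact r)" for m
  define c where "c m = real r * real m ^ (k + 1) / fact r" for m
  \<comment> \<open>The factor 8 is \<open>2 + 2 * 3\<close>, from \<open>(m + T\<^sup>2)\<^sup>2 \<le> 2 * m\<^sup>2 + 2 * T ^ 4\<close> and the fourth moment bound \<open>3 * m\<^sup>2\<close>.\<close>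
  define K' where "K' = real (card D) * (\<Sum>d\<in>D. (J d / fact r)\<^sup>2 * (8 * real r ^ 4))"
  have Z_dev: "Z m \<omega> - a m - c m * (\<Sum>i<m. Y i \<omega>) = (\<Sum>d\<in>D. J d / fact r * R d m \<omega>)" for m \<omega>
  proof -
    have "(\<Sum>i<m. Y i \<omega>) = (\<Sum>d\<in>D. J d * p d ^ (k + 1) * T d m \<omega>)"
      unfolding Y_U T_def by (subst sum.swap) (simp add: sum_distrib_left)
    then have "Z m \<omega> - a m - c m * (\<Sum>i<m. Y i \<omega>) = (\<Sum>d\<in>D. J d * real (N d m \<omega> choose r)
        - J d * (real m * p d) ^ r / fact r - c m * (J d * p d ^ (k + 1) * T d m \<omega>))"
      by (simp add: Z_eq a_def sum_subtractf sum_distrib_left)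
    also have "\<dots> = (\<Sum>d\<in>D. J d / fact r * R d m \<omega>)"
      by (intro sum.cong refl) (simp add: R_def c_def power_mult_distrib field_simps)
    finally show ?thesis .
  qed
  have err: "expectation (\<lambda>\<omega>. (Z m \<omega> - a m - c m * (\<Sum>i<m. Y i \<omega>))\<^sup>2) \<le> K' * real m ^ (2 * k + 2)" for m
  proof -
    have "expectation (\<lambda>\<omega>. (Z m \<omega> - a m - c m * (\<Sum>i<m. Y i \<omega>))\<^sup>2)
        \<le> expectation (\<lambda>\<omega>. real (card D) * (\<Sum>d\<in>D. (J d / fact r)\<^sup>2
            * (real r ^ 4 * real m ^ (2 * k) * (2 * (real m)\<^sup>2 + 2 * T d m \<omega> ^ 4))))"
    proof (rule integral_mono')
      fix \<omega>
      have "(Z m \<omega> - a m - c m * (\<Sum>i<m. Y i \<omega>))\<^sup>2 \<le> (\<Sum>d\<in>D. (J d / fact r * R d m \<omega>)\<^sup>2) * real (card D)"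
        unfolding Z_dev by (rule sum_squared_le_sum_of_squares)
      also have "\<dots> \<le> (\<Sum>d\<in>D. (J d / fact r)\<^sup>2
            * (real r ^ 4 * real m ^ (2 * k) * (2 * (real m)\<^sup>2 + 2 * T d m \<omega> ^ 4))) * real (card D)"
        unfolding power_mult_distrib by (intro mult_right_mono sum_mono mult_left_mono R2_le) auto
      finally show "(Z m \<omega> - a m - c m * (\<Sum>i<m. Y i \<omega>))\<^sup>2 \<le> real (card D) * (\<Sum>d\<in>D. (J d / fact r)\<^sup>2
            * (real r ^ 4 * real m ^ (2 * k) * (2 * (real m)\<^sup>2 + 2 * T d m \<omega> ^ 4)))"
        by (simp only: mult.commute)
    next
      show "0 \<le> real (card D) * (\<Sum>d\<in>D. (J d / fact r)\<^sup>2
            * (real r ^ 4 * real m ^ (2 * k) * (2 * (real m)\<^sup>2 + 2 * T d m \<omega> ^ 4)))" for \<omega>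
        by (intro mult_nonneg_nonneg sum_nonneg add_nonneg_nonneg) auto
    qed (use T4_int in simp)
    also have "\<dots> = real (card D) * (\<Sum>d\<in>D. (J d / fact r)\<^sup>2
            * (real r ^ 4 * real m ^ (2 * k) * (2 * (real m)\<^sup>2 + 2 * expectation (\<lambda>\<omega>. T d m \<omega> ^ 4))))"
      using T4_int by (simp add: prob_space)
    also have "\<dots> \<le> real (card D) * (\<Sum>d\<in>D. (J d / fact r)\<^sup>2
            * (real r ^ 4 * real m ^ (2 * k) * (2 * (real m)\<^sup>2 + 2 * (3 * (real m)\<^sup>2))))"
      by (intro mult_left_mono sum_mono add_mono T4) auto
    also have "\<dots> = K' * real m ^ (2 * k + 2)"
      unfolding K'_def mult.assoc sum_distrib_right
      by (rule arg_cong2[of _ _ _ _ "(*)", OF refl sum.cong[OF refl]]) (simp add: power_add power2_eq_square)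
    finally show ?thesis .
  qed

  show ?thesis
  proof (rule asymptotic_normality_of_perturbed_iid_sum)
    show "indep_vars (\<lambda>_. borel) Y UNIV" unfolding Y_def[abs_def] by (rule indep_f)
    show "distr M borel (Y i) = distr \<nu> borel g" for i
      unfolding ident[of i, symmetric] Y_def[abs_def] by (subst distr_distr) (auto simp: comp_def)
    show "integrable M (\<lambda>\<omega>. (Y i \<omega>)\<^sup>2)" for i
    proof (rule integrable_const_bound[where B="(\<Sum>d\<in>D. \<bar>J d * p d ^ (k + 1)\<bar>)\<^sup>2"])
      have "\<bar>Y i \<omega>\<bar> \<le> (\<Sum>d\<in>D. \<bar>J d * p d ^ (k + 1)\<bar>)" for \<omega>
        unfolding Y_U using U_le
        by (intro order_trans[OF sum_abs] sum_mono) (auto simp: abs_mult intro!: mult_left_le)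
      then show "AE \<omega> in M. norm ((Y i \<omega>)\<^sup>2) \<le> (\<Sum>d\<in>D. \<bar>J d * p d ^ (k + 1)\<bar>)\<^sup>2"
        by (auto simp: power2_le_iff_abs_le sum_nonneg)
    qed (simp add: Y_def[abs_def])
    have U_int: "integrable M (U d i)" for d i
      by (rule integrable_const_bound[where B=1]) (use U_le in auto)
    show "expectation (Y i) = 0" for i
      unfolding Y_U[abs_def] using U_int U_mean by simp
    show "\<sigma> > 0" using nondeg by (simp add: \<sigma>_def)
    show "expectation (\<lambda>\<omega>. (Y i \<omega>)\<^sup>2) = \<sigma>\<^sup>2" for i
      unfolding Y_def using E_V[of "\<lambda>x. (g x)\<^sup>2" i] nondeg by (simp add: \<sigma>_def)
    show "c m > 0" if "m > 0" for m using that by (simp add: c_def r_def)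
    show "expectation (\<lambda>\<omega>. (Z m \<omega> - a m - c m * (\<Sum>i<m. Y i \<omega>))\<^sup>2) \<le> K' / (real r / fact r)\<^sup>2 * (c m)\<^sup>2" for m
    proof -
      have "(c m)\<^sup>2 = (real r / fact r)\<^sup>2 * real m ^ (2 * k + 2)"
        by (simp add: c_def power_mult_distrib power_divide flip: power_mult) (simp add: algebra_simps power2_eq_square)
      moreover have "real r / fact r \<noteq> 0" by (simp add: r_def)
      ultimately show ?thesis using err[of m] by simp
    qed
  qed (use Z2 in simp_all)
qed

section \<open>Divisor expansion of the gcd sum\<close>

text \<open>Moebius inversion in the weak form of a triangular linear system: the value \<open>J k\<close> is determined by
\<open>f k\<close> and the values of \<open>J\<close> at the proper divisors of \<open>k\<close>. For \<open>f k = k ^ q\<close> the solution is Jordan's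
totient function.\<close>

lemma divisor_sum_decomposition:
  fixes f :: "nat \<Rightarrow> real"
  obtains J where "\<And>k. k \<in> {1..n} \<Longrightarrow> f k = (\<Sum>d\<in>{1..n}. J d * of_bool (d dvd k))"
proof -
  have "\<exists>J. \<forall>k\<in>{1..n}. f k = (\<Sum>d\<in>{1..n}. J d * of_bool (d dvd k))"
  proof (induction n)
    case (Suc n)
    then obtain J where J: "\<And>k. k \<in> {1..n} \<Longrightarrow> f k = (\<Sum>d\<in>{1..n}. J d * of_bool (d dvd k))" by auto
    define J' where "J' = J(Suc n := f (Suc n) - (\<Sum>d\<in>{1..n}. J d * of_bool (d dvd Suc n)))"
    have same: "(\<Sum>d\<in>{1..n}. J' d * of_bool (d dvd k)) = (\<Sum>d\<in>{1..n}. J d * of_bool (d dvd k))" for k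
      by (intro sum.cong) (auto simp: J'_def)
    have "f k = (\<Sum>d\<in>{1..Suc n}. J' d * of_bool (d dvd k))" if "k \<in> {1..Suc n}" for k
    proof (cases "k = Suc n")
      case True
      then show ?thesis using same[of k] by (simp add: J'_def)
    next
      case False
      with that have k: "k \<in> {1..n}" by auto
      then have "\<not> Suc n dvd k" by (auto dest: dvd_imp_le)
      then show ?thesis using same[of k] J[OF k] by simp
    qed
    then show ?case by blast
  qed simp
  then show thesis using that by blast
qed

lemma bij_betw_increasing_tuples:
  "bij_betw set (increasing_tuples r m) {B. B \<subseteq> {1..m} \<and> card B = r}"
proof (rule bij_betw_imageI)
  show "inj_on set (increasing_tuples r m)"
    by (auto simp: inj_on_def increasing_tuples_def intro: strict_sorted_equal)
  show "set ` increasing_tuples r m = {B. B \<subseteq> {1..m} \<and> card B = r}"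
  proof (intro equalityI subsetI)
    fix B assume "B \<in> {B. B \<subseteq> {1..m} \<and> card B = r}"
    then have "sorted_list_of_set B \<in> increasing_tuples r m" "set (sorted_list_of_set B) = B"
      using finite_subset[of B "{1..m}"] by (auto simp: increasing_tuples_def)
    then show "B \<in> set ` increasing_tuples r m" by (metis imageI)
  qed (auto simp: increasing_tuples_def strict_sorted_iff distinct_card)
qed

lemma finite_increasing_tuples: "finite (increasing_tuples r m)"
proof -
  have "finite {B. B \<subseteq> {1..m} \<and> card B = r}"
    by (rule finite_subset[of _ "Pow {1..m}"]) auto
  then show ?thesis using bij_betw_finite[OF bij_betw_increasing_tuples] by blast
qed

text \<open>An increasing tuple all of whose entries satisfy \<open>P\<close> is the same as an \<open>r\<close>-element subset of the indices
that satisfy \<open>P\<close>.\<close>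

lemma card_increasing_tuples_in:
  "card {is \<in> increasing_tuples r m. \<forall>i\<in>set is. P i} = card {i\<in>{1..m}. P i} choose r"
proof -
  have "bij_betw set {is \<in> increasing_tuples r m. \<forall>i\<in>set is. P i}
      {B. B \<subseteq> {i\<in>{1..m}. P i} \<and> card B = r}"
  proof (rule bij_betw_subset[OF bij_betw_increasing_tuples[of r m]])
    have "set ` {is \<in> increasing_tuples r m. \<forall>i\<in>set is. P i}
        = {B \<in> set ` increasing_tuples r m. \<forall>i\<in>B. P i}" by auto
    also have "\<dots> = {B. B \<subseteq> {i\<in>{1..m}. P i} \<and> card B = r}"
      unfolding bij_betw_imp_surj_on[OF bij_betw_increasing_tuples] by auto
    finally show "set ` {is \<in> increasing_tuples r m. \<forall>i\<in>set is. P i}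
        = {B. B \<subseteq> {i\<in>{1..m}. P i} \<and> card B = r}" .
  qed auto
  then show ?thesis by (simp add: bij_betw_same_card n_subsets)
qed

text \<open>The key reduction. Since \<open>d\<close> divides a gcd iff it divides every entry, expanding the power of the gcd
over its divisors turns the sum over tuples into a linear combination of binomial coefficients of the
numbers of multiples of \<open>d\<close> in the sample.\<close>

lemma gcd_power_sum_eq_divisor_sum:
  assumes J: "\<And>k. k \<in> {1..n} \<Longrightarrow> real k ^ q = (\<Sum>d\<in>{1..n}. J d * of_bool (d dvd k))"
    and X: "\<And>i. i \<in> {1..m} \<Longrightarrow> X i \<omega> \<in> {1..n}" and r: "r > 0"
  shows "gcd_power_sum r q X m \<omega> = (\<Sum>d\<in>{1..n}. J d * real (card {i\<in>{1..m}. d dvd X i \<omega>} choose r))"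
proof -
  have "real (Gcd (set (map (\<lambda>i. X i \<omega>) is))) ^ q
      = (\<Sum>d\<in>{1..n}. J d * of_bool (\<forall>i\<in>set is. d dvd X i \<omega>))" if "is": "is \<in> increasing_tuples r m" for "is"
  proof -
    let ?G = "Gcd ((\<lambda>i. X i \<omega>) ` set is)"
    have "set is \<noteq> {}" using "is" r by (auto simp: increasing_tuples_def)
    then obtain i where i: "i \<in> set is" by (metis ex_in_conv)
    then have im: "i \<in> {1..m}" using "is" by (auto simp: increasing_tuples_def)
    then have "?G dvd X i \<omega>" by (intro Gcd_dvd imageI i)
    then have "?G \<in> {1..n}" using X[OF im] by (auto dest: dvd_imp_le intro!: Suc_leI gr0I)
    from J[OF this] show ?thesis by (simp add: dvd_Gcd_iff)
  qed
  then have "gcd_power_sum r q X m \<omega>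
      = (\<Sum>is\<in>increasing_tuples r m. \<Sum>d\<in>{1..n}. J d * of_bool (\<forall>i\<in>set is. d dvd X i \<omega>))"
    unfolding gcd_power_sum_def by (intro sum.cong) auto
  also have "\<dots> = (\<Sum>d\<in>{1..n}. J d * (\<Sum>is\<in>increasing_tuples r m. of_bool (\<forall>i\<in>set is. d dvd X i \<omega>)))"
    by (subst sum.swap) (simp add: sum_distrib_left)
  also have "\<dots> = (\<Sum>d\<in>{1..n}. J d * real (card {i\<in>{1..m}. d dvd X i \<omega>} choose r))"
    by (simp add: sum_of_bool_eq finite_increasing_tuples Int_def card_increasing_tuples_in)
  finally show ?thesis .
qed

lemma measurable_gcd_power_sum:
  assumes X: "\<And>i. i \<ge> 1 \<Longrightarrow> X i \<in> measurable M (count_space UNIV)"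
  shows "gcd_power_sum r q X m \<in> borel_measurable M"
proof -
  have "(\<lambda>\<omega>. Gcd (set (map (\<lambda>i. X i \<omega>) is))) \<in> measurable M (count_space UNIV)"
    if "set is \<subseteq> {1..m}" for "is"
    using that
  proof (induction "is")
    case (Cons i "is")
    then have [measurable]: "X i \<in> measurable M (count_space UNIV)"
      and [measurable]: "(\<lambda>\<omega>. Gcd (set (map (\<lambda>i. X i \<omega>) is))) \<in> measurable M (count_space UNIV)"
      using X by auto
    have "(\<lambda>\<omega>. gcd (X i \<omega>) (Gcd (set (map (\<lambda>i. X i \<omega>) is)))) \<in> measurable M (count_space UNIV)"
      by measurable
    then show ?case by simp
  qed simp
  then have "(\<lambda>\<omega>. real (Gcd (set (map (\<lambda>i. X i \<omega>) is))) ^ q) \<in> borel_measurable M"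
    if "is \<in> increasing_tuples r m" for "is"
    using that by (intro borel_measurable_power measurable_compose[of _ M "count_space UNIV" real])
      (auto simp: increasing_tuples_def)
  then show ?thesis unfolding gcd_power_sum_def[abs_def] by (rule borel_measurable_sum)
qed

section \<open>Asymptotic normality of the gcd sum\<close>

theorem theorem6p1:
  fixes M :: "'a measure"
    and X :: "nat \<Rightarrow> 'a \<Rightarrow> nat"
    and r q n :: nat
  defines "Z \<equiv> gcd_power_sum r q X"
  assumes "prob_space M"
    and "r \<ge> 2" and "q \<ge> 1" and "n \<ge> 2"
    and "prob_space.indep_vars M (\<lambda>_. count_space UNIV) X {1..}"
    and "\<And>i. i \<ge> 1 \<Longrightarrow> distr M (count_space UNIV) (X i) = measure_pmf (pmf_of_set {1..n})"
  shows "weak_conv_m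
           (\<lambda>m. distr M borel
              (\<lambda>\<omega>. (Z m \<omega> - prob_space.expectation M (Z m)) / sqrt (prob_space.variance M (Z m))))
           std_normal_distribution"
proof -
  interpret prob_space M by fact
  note n = \<open>n \<ge> 2\<close> and distr_X = assms(7)
  define \<nu> where "\<nu> = measure_pmf (pmf_of_set {1..n})"
  have X_rv[measurable]: "X i \<in> measurable M (count_space UNIV)" if "i \<ge> 1" for i
    using assms(6) that by (auto simp: indep_vars_def2)
  obtain k where k: "r = k + 2" using \<open>r \<ge> 2\<close> by (metis add.commute le_Suc_ex)
  obtain J where J: "\<And>x. x \<in> {1..n} \<Longrightarrow> real x ^ q = (\<Sum>d\<in>{1..n}. J d * of_bool (d dvd x))"
    using divisor_sum_decomposition[of n "\<lambda>x. real x ^ q"] by blast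

  \<comment> \<open>Nondegeneracy only needs the values of \<open>J\<close> at 1 and 2, which are those of Jordan's totient.\<close>
  have "1 = (\<Sum>d\<in>{1..n}. J d * of_bool (d dvd (1::nat)))" using J[of 1] n by simp
  also have "\<dots> = (\<Sum>d\<in>{1}. J d * of_bool (d dvd (1::nat)))"
    using n by (intro sum.mono_neutral_right) auto
  finally have J1: "J 1 = 1" by simp
  have dvd2: "d dvd 2 \<longleftrightarrow> d = 1 \<or> d = 2" for d :: nat
    using two_is_prime_nat by (auto simp: prime_nat_iff)
  have "2 ^ q = (\<Sum>d\<in>{1..n}. J d * of_bool (d dvd (2::nat)))" using J[of 2] n by simp
  also have "\<dots> = (\<Sum>d\<in>{1,2}. J d * of_bool (d dvd (2::nat)))"
    using n dvd2 by (intro sum.mono_neutral_right) auto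
  finally have J2: "J 2 = 2 ^ q - 1" using J1 by simp
  moreover have "(2::real) ^ q > 1" using \<open>q \<ge> 1\<close> by (intro one_less_power) auto
  ultimately have J2_pos: "J 2 > 0" by simp

  define p where "p d = measure \<nu> {x. d dvd x}" for d :: nat
  define g where "g x = (\<Sum>d\<in>{1..n}. J d * p d ^ (k + 1) * (of_bool (d dvd x) - p d))" for x
  have in_supp: "x \<in> set_pmf (pmf_of_set {1..n})" if "x \<in> {1..n}" for x
    using that n by (subst set_pmf_of_set) auto
  have "measure \<nu> {x. 2 dvd x} \<ge> measure \<nu> {2}"
    unfolding \<nu>_def by (intro measure_pmf.finite_measure_mono) auto
  moreover have "measure \<nu> {2} > 0"
    unfolding \<nu>_def using in_supp[of 2] n by (simp add: measure_pmf_single pmf_positive)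
  ultimately have p2: "p 2 > 0" by (simp add: p_def)
  \<comment> \<open>The numbers 1 and 2 both occur with positive probability and have the same divisors except for 2, so the projection \<open>g\<close> separates them.\<close>
  have "g 2 - g 1 = (\<Sum>d\<in>{1..n}. J d * p d ^ (k + 1) * (of_bool (d dvd 2) - of_bool (d dvd 1)))"
    unfolding g_def by (subst sum_subtractf[symmetric]) (simp add: algebra_simps)
  also have "\<dots> = (\<Sum>d\<in>{2}. J d * p d ^ (k + 1) * (of_bool (d dvd 2) - of_bool (d dvd 1)))"
    using n dvd2 by (intro sum.mono_neutral_right) auto
  also have "\<dots> = J 2 * p 2 ^ (k + 1)" by simp
  also have "\<dots> > 0" using J2_pos p2 by simp
  finally have g12: "g 1 \<noteq> 0 \<or> g 2 \<noteq> 0" by auto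
  have g_int: "(\<integral>x. (g x)\<^sup>2 \<partial>\<nu>) = (\<Sum>x\<in>{1..n}. (g x)\<^sup>2) / real n"
    unfolding \<nu>_def using integral_pmf_of_set[of "{1..n}"] n by simp
  moreover have "(\<Sum>x\<in>{1..n}. (g x)\<^sup>2) > 0"
    using g12
  proof
    assume "g 1 \<noteq> 0"
    then show ?thesis by (intro sum_pos2[of _ 1]) (use n in auto)
  next
    assume "g 2 \<noteq> 0"
    then show ?thesis by (intro sum_pos2[of _ 2]) (use n in auto)
  qed
  ultimately have nondeg: "(\<integral>x. (g x)\<^sup>2 \<partial>\<nu>) > 0" using n by simp

  define V where "V i = X (Suc i)" for i
  have "indep_vars (\<lambda>_. count_space UNIV) X (range Suc)"
    by (rule indep_vars_subset[OF assms(6)]) auto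
  then have V_indep: "indep_vars (\<lambda>_. count_space UNIV) V UNIV"
    unfolding V_def[abs_def] by (rule indep_vars_reindex) simp
  have V_distr: "distr M (count_space UNIV) (V i) = \<nu>" for i
    using distr_X[of "Suc i"] by (simp add: V_def \<nu>_def)
  define Z' where "Z' = (\<lambda>m \<omega>. \<Sum>d\<in>{1..n}. J d * real (card {i\<in>{..<m}. d dvd V i \<omega>} choose (k + 2)))"
  have conv: "weak_conv_m
      (\<lambda>m. distr M borel (\<lambda>\<omega>. (Z' m \<omega> - expectation (Z' m)) / sqrt (variance (Z' m)))) std_normal_distribution"
    unfolding Z'_def
    by (rule asymptotic_normality_of_binomials_of_counts[OF V_indep V_distr])
      (use nondeg in \<open>simp_all add: g_def p_def\<close>)

  have [measurable]: "Z m \<in> borel_measurable M" for m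
    unfolding Z_def by (rule measurable_gcd_power_sum) (rule X_rv)
  have [measurable]: "(\<lambda>\<omega>. card {i\<in>{..<m}. d dvd V i \<omega>}) \<in> measurable M (count_space UNIV)" for d m
    by (rule measurable_card_hits) (simp add: V_def)
  have [measurable]: "Z' m \<in> borel_measurable M" for m
    unfolding Z'_def by measurable
  have "AE \<omega> in M. X i \<omega> \<in> {1..n}" if "i \<ge> 1" for i
  proof -
    have "AE x in distr M (count_space UNIV) (X i). x \<in> {1..n}"
      unfolding distr_X[OF that] using n by (subst AE_measure_pmf_iff) simp
    then show ?thesis using that by (subst (asm) AE_distr_iff) auto
  qed
  then have X_range: "AE \<omega> in M. \<forall>i\<in>{1..m}. X i \<omega> \<in> {1..n}" for m
    by (intro AE_finite_allI) auto
  \<comment> \<open>Almost surely all samples lie in \<open>{1..n}\<close>, where the divisor expansion is valid; this is enough for laws, means and variances.\<close>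
  have Z_eq: "AE \<omega> in M. Z m \<omega> = Z' m \<omega>" for m
    using X_range[of m]
  proof eventually_elim
    case (elim \<omega>)
    have "card {i\<in>{1..m}. d dvd X i \<omega>} = card {i\<in>{..<m}. d dvd V i \<omega>}" for d
    proof -
      have "{i\<in>{1..m}. d dvd X i \<omega>} = Suc ` {i\<in>{..<m}. d dvd V i \<omega>}"
        by (auto simp: V_def image_iff Suc_le_eq gr0_conv_Suc)
      then show ?thesis by (simp add: card_image)
    qed
    then show ?case
      unfolding Z_def Z'_def using gcd_power_sum_eq_divisor_sum[OF J, where X=X] elim k by simp
  qed
  have "expectation (Z m) = expectation (Z' m)" for m
    using Z_eq by (intro integral_cong_AE) auto
  moreover have "variance (Z m) = variance (Z' m)" for m
    using Z_eq[of m] by (intro integral_cong_AE) (auto simp: calculation elim!: eventually_mono)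
  ultimately have "distr M borel (\<lambda>\<omega>. (Z m \<omega> - expectation (Z m)) / sqrt (variance (Z m)))
      = distr M borel (\<lambda>\<omega>. (Z' m \<omega> - expectation (Z' m)) / sqrt (variance (Z' m)))" for m
    using Z_eq[of m] by (intro distr_cong_AE) (auto elim!: eventually_mono)
  with conv show ?thesis by simp
qed

end
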